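(* Borel orbit closures of type $D$ (meaning $\varepsilon=1$ and $n$ even) are not induced by type $A$. That is, for $\varepsilon=1$ and $n=2l$ even, the orbit-closure relation of $B(1)$ on $\mathcal{N}^{(2)}(1)$ is not induced by type $A$: it is not the case that $\overline{B\cdot A}\cap\mathcal{N}^{(2)}(1)=\overline{B(1)\cdot A}$ holds for every $A\in\mathcal{N}^{(2)}(1)$.
   Context: The base field is $\mathrm{k}=\mathbb{C}$; closures are Zariski closures. Let $n=2l$ or $n=2l+1$ be a positive integer, let $\varepsilon\in\{\pm1\}$, and let $U=\mathrm{k}^n$ be equipped with a non-degenerate bilinear form $\langle-,-\rangle_U$ satisfying $\langle v,w\rangle_U=\varepsilon\langle w,v\rangle_U$ for all $v,w\in U$. For an endomorphism $f$ of $U$, $f^t$ denotes its adjoint with respect to the form. Let $\rho$ be the involution $g\mapsto g^\rho=(g^t)^{-1}$ of $\mathrm{GL}(\mathrm{k}^n)$; its fixed point group is the orthogonal group $\mathrm{O}_n$ if $\varepsilon=1$ and the symplectic group $\mathrm{SP}_n$ if $\varepsilon=-1$. $\mathcal{N}^{(2)}$ is the set of $n\times n$ matrices $A$ with $A^2=0$ ($2$-nilpotent matrices), $\Delta$ is the involution $\Delta(A)=-A^t$ of $\mathcal{N}^{(2)}$, and $\mathcal{N}^{(2)}(\varepsilon)=\{A\in\mathcal{N}^{(2)}\mid A^t=-A\}$ is its set of fixed points. Fix a maximal isotropic flag $U_1\subset\cdots\subset U_l\subset U$ (each $U_i$ totally isotropic with $\dim U_i=i$, and $U_l$ totally isotropic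 of maximal dimension), giving the complete flag $\mathcal{F}_\bullet=(U_1\subset\cdots\subset U_l\subseteq U_l^\perp\subset U_{l-1}^\perp\subset\cdots\subset U_1^\perp\subset U)$. $B\subset\mathrm{GL}(\mathrm{k}^n)$ is the stabilizer of $\mathcal{F}_\bullet$; it satisfies $\rho(B)=B$, and $B(\varepsilon)=B^\rho$ is the group of its $\rho$-fixed points, a Borel subgroup of the fixed point group of $\rho$ on $\mathrm{GL}(\mathrm{k}^n)$. $B$ acts on $\mathcal{N}^{(2)}$ by conjugation, and $B(\varepsilon)$ acts on $\mathcal{N}^{(2)}(\varepsilon)$ by conjugation. The orbit-closure relation of $B(\varepsilon)$ on $\mathcal{N}^{(2)}(\varepsilon)$ is said to be induced by type $A$ if $\overline{B\cdot A}\cap\mathcal{N}^{(2)}(\varepsilon)=\overline{B(\varepsilon)\cdot A}$ for every $A\in\mathcal{N}^{(2)}(\varepsilon)$.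
   Formalization: The claim is proved for n = 2l with l ≥ 2; for n = 2 it fails, since there the only 2-nilpotent matrix with A^t = −A is 0, so both orbit closures equal {0}. *)

theory Defs
  imports "HOL-Analysis.Analysis"
begin

inductive matrix_poly :: "(complex^'n^'n \<Rightarrow> complex) \<Rightarrow> bool" where
  const: "matrix_poly (\<lambda>_. c)"
| entry: "matrix_poly (\<lambda>X. X $ i $ j)"
| add: "matrix_poly p \<Longrightarrow> matrix_poly q \<Longrightarrow> matrix_poly (\<lambda>X. p X + q X)"
| mult: "matrix_poly p \<Longrightarrow> matrix_poly q \<Longrightarrow> matrix_poly (\<lambda>X. p X * q X)"

definition zariski_closed :: "(complex^'n^'n) set \<Rightarrow> bool" where
  "zariski_closed Z \<longleftrightarrow> (\<exists>P. (\<forall>p\<in>P. matrix_poly p) \<and> Z = {X. \<forall>p\<in>P. p X = 0})"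

(* The closure is taken in the space of all matrices. Since nilp2 and nilp2_skew below are
   Zariski closed there, it agrees with the closure inside these varieties. *)
definition zariski_closure :: "(complex^'n^'n) set \<Rightarrow> (complex^'n^'n) set" where
  "zariski_closure S = zariski_closed hull S"

(* Linearity is over the complex numbers; the library's predicate "bilinear" is real. *)
definition eps_form :: "complex \<Rightarrow> (complex^'n \<Rightarrow> complex^'n \<Rightarrow> complex) \<Rightarrow> bool" where
  "eps_form \<epsilon> \<beta> \<longleftrightarrow>
     (\<forall>v. Vector_Spaces.linear (*s) (*) (\<lambda>w. \<beta> v w)) \<and>
     (\<forall>w. Vector_Spaces.linear (*s) (*) (\<lambda>v. \<beta> v w)) \<and>
     (\<forall>v. (\<forall>w. \<beta> v w = 0) \<longrightarrow> v = 0) \<and>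
     (\<forall>v w. \<beta> v w = \<epsilon> * \<beta> w v)"

(* Exists and is unique as soon as the form is bilinear and non-degenerate. *)
definition form_adjoint ::
    "(complex^'n \<Rightarrow> complex^'n \<Rightarrow> complex) \<Rightarrow> complex^'n^'n \<Rightarrow> complex^'n^'n" where
  "form_adjoint \<beta> A = (THE A'. \<forall>v w. \<beta> (A *v v) w = \<beta> v (A' *v w))"

definition rho :: "(complex^'n \<Rightarrow> complex^'n \<Rightarrow> complex) \<Rightarrow> complex^'n^'n \<Rightarrow> complex^'n^'n" where
  "rho \<beta> g = matrix_inv (form_adjoint \<beta> g)"

definition nilp2 :: "(complex^'n^'n) set" where
  "nilp2 = {A. A ** A = 0}"

definition nilp2_skew :: "(complex^'n \<Rightarrow> complex^'n \<Rightarrow> complex) \<Rightarrow> (complex^'n^'n) set" where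
  "nilp2_skew \<beta> = {A \<in> nilp2. form_adjoint \<beta> A = - A}"

definition form_perp ::
    "(complex^'n \<Rightarrow> complex^'n \<Rightarrow> complex) \<Rightarrow> (complex^'n) set \<Rightarrow> (complex^'n) set" where
  "form_perp \<beta> W = {v. \<forall>w\<in>W. \<beta> v w = 0}"

definition isotropic_subspace ::
    "(complex^'n \<Rightarrow> complex^'n \<Rightarrow> complex) \<Rightarrow> (complex^'n) set \<Rightarrow> bool" where
  "isotropic_subspace \<beta> W \<longleftrightarrow> vec.subspace W \<and> (\<forall>v\<in>W. \<forall>w\<in>W. \<beta> v w = 0)"

(* Only the values of F at the indices 1, ..., l are relevant. *)
definition max_isotropic_flag ::
    "(complex^'n \<Rightarrow> complex^'n \<Rightarrow> complex) \<Rightarrow> nat \<Rightarrow> (nat \<Rightarrow> (complex^'n) set) \<Rightarrow> bool" where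
  "max_isotropic_flag \<beta> l F \<longleftrightarrow>
     (\<forall>i\<in>{1..l}. isotropic_subspace \<beta> (F i) \<and> vec.dim (F i) = i) \<and>
     (\<forall>i\<in>{1..<l}. F i \<subseteq> F (Suc i)) \<and>
     (\<forall>W. isotropic_subspace \<beta> W \<longrightarrow> vec.dim W \<le> l)"

definition complete_flag ::
    "(complex^'n \<Rightarrow> complex^'n \<Rightarrow> complex) \<Rightarrow> nat \<Rightarrow> (nat \<Rightarrow> (complex^'n) set)
      \<Rightarrow> (complex^'n) set set" where
  "complete_flag \<beta> l F = F ` {1..l} \<union> (\<lambda>i. form_perp \<beta> (F i)) ` {1..l}"

definition borel_GL ::
    "(complex^'n \<Rightarrow> complex^'n \<Rightarrow> complex) \<Rightarrow> nat \<Rightarrow> (nat \<Rightarrow> (complex^'n) set)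
      \<Rightarrow> (complex^'n^'n) set" where
  "borel_GL \<beta> l F = {g. invertible g \<and> (\<forall>W\<in>complete_flag \<beta> l F. (*v) g ` W = W)}"

definition borel_fixed ::
    "(complex^'n \<Rightarrow> complex^'n \<Rightarrow> complex) \<Rightarrow> nat \<Rightarrow> (nat \<Rightarrow> (complex^'n) set)
      \<Rightarrow> (complex^'n^'n) set" where
  "borel_fixed \<beta> l F = {g \<in> borel_GL \<beta> l F. rho \<beta> g = g}"

definition conj_orbit :: "(complex^'n^'n) set \<Rightarrow> complex^'n^'n \<Rightarrow> (complex^'n^'n) set" where
  "conj_orbit G A = (\<lambda>g. g ** A ** matrix_inv g) ` G"

definition induced_by_type_A ::
    "(complex^'n \<Rightarrow> complex^'n \<Rightarrow> complex) \<Rightarrow> nat \<Rightarrow> (nat \<Rightarrow> (complex^'n) set) \<Rightarrow> bool" where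
  "induced_by_type_A \<beta> l F \<longleftrightarrow>
     (\<forall>A\<in>nilp2_skew \<beta>.
        zariski_closure (conj_orbit (borel_GL \<beta> l F) A) \<inter> nilp2_skew \<beta> =
        zariski_closure (conj_orbit (borel_fixed \<beta> l F) A))"

end

(* Choose a nonzero a in U_{l-1}, a vector b in U_l outside U_{l-1}, and an isotropic c orthogonal
   to U_{l-1} with <b,c> = 1. Put A v = <v,c> a - <v,a> c and X v = <v,b> a - <v,a> b; both are
   skew of square zero. X is a limit of B-conjugates of A along an explicit curve. On the other
   hand, an isometry h stabilizing the flag sends c to an isotropic vector of the orthogonal of
   U_{l-1}; modulo U_{l-1} that orthogonal is a plane with only two isotropic lines, spanned by b
   and c, and h fixes both, because it fixes U_l. Hence every M in the B(1)-orbit of A satisfies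
   the closed condition M c = 0, whereas X c = a is nonzero. *)

theory Submission imports Defs begin

section \<open>Zariski closures, Euclidean limits and inverses\<close>

lemma matrix_poly_continuous: "matrix_poly p \<Longrightarrow> continuous_on S p"
  by (induction rule: matrix_poly.induct) (auto intro!: continuous_intros)

lemma zariski_closed_imp_closed: "zariski_closed Z \<Longrightarrow> closed Z"
proof -
  assume "zariski_closed Z"
  then obtain P where P: "\<And>p. p \<in> P \<Longrightarrow> matrix_poly p" and Z: "Z = {X. \<forall>p\<in>P. p X = 0}"
    unfolding zariski_closed_def by blast
  have "Z = (\<Inter>p\<in>P. {X. p X = 0})"
    using Z by auto
  moreover have "closed {X. p X = 0}" if "p \<in> P" for p
    using matrix_poly_continuous[OF P[OF that]] by (intro closed_Collect_eq) auto
  ultimately show ?thesis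
    by (simp add: closed_INT)
qed

text \<open>Polynomials are continuous, so every Zariski closed set containing \<open>S\<close> is
  closed in the Euclidean topology and keeps the limit. This turns a degeneration into an ordinary
  sequence.\<close>

lemma zariski_closure_limit:
  assumes "\<And>k::nat. X k \<in> S" and "X \<longlonglongrightarrow> Y"
  shows "Y \<in> zariski_closure S"
  unfolding zariski_closure_def hull_def
proof (safe)
  fix Z assume "zariski_closed Z" "S \<subseteq> Z"
  then show "Y \<in> Z"
    using closed_sequentially[of Z X Y] zariski_closed_imp_closed assms by blast
qed

lemma matrix_poly_sum:
  "finite I \<Longrightarrow> (\<And>i. i \<in> I \<Longrightarrow> matrix_poly (p i)) \<Longrightarrow> matrix_poly (\<lambda>X. \<Sum>i\<in>I. p i X)"
  by (induction rule: finite_induct) (auto intro: matrix_poly.intros)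

text \<open>The coordinates of \<open>X *v c\<close> are linear polynomials in the entries of
  \<open>X\<close>. This is the closed condition that will separate the two closures.\<close>

lemma zariski_closed_annihilator: "zariski_closed {X. X *v c = 0}"
  unfolding zariski_closed_def
proof (intro exI conjI)
  let ?P = "range (\<lambda>i X. \<Sum>j\<in>UNIV. X $ i $ j * c $ j)"
  show "\<forall>p\<in>?P. matrix_poly p"
    by (auto intro!: matrix_poly_sum matrix_poly.intros)
  show "{X. X *v c = 0} = {X. \<forall>p\<in>?P. p X = 0}"
    by (auto simp: vec_eq_iff matrix_vector_mult_def)
qed

lemma matrix_inv_eqI:
  fixes g h :: "complex^'n^'n"
  assumes "h ** g = mat 1"
  shows "matrix_inv g = h"
proof -
  have "g ** h = mat 1"
    using assms by (simp add: matrix_left_right_inverse)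
  then have "g ** matrix_inv g = mat 1"
    using assms unfolding matrix_inv_def by (metis (mono_tags, lifting) someI_ex)
  then have "h ** (g ** matrix_inv g) = h"
    by simp
  then show ?thesis
    by (simp add: matrix_mul_assoc assms)
qed

section \<open>Symmetric forms: orthogonals, adjoints, isometries\<close>

locale quadratic_space =
  fixes \<beta> :: "complex^'n \<Rightarrow> complex^'n \<Rightarrow> complex"
  assumes form: "eps_form 1 \<beta>"
begin

lemma form_sym: "\<beta> v w = \<beta> w v"
  using form unfolding eps_form_def by simp

lemma form_nondeg: "(\<And>w. \<beta> v w = 0) \<Longrightarrow> v = 0"
  using form unfolding eps_form_def by blast

lemma linear_right: "Vector_Spaces.linear (*s) (*) (\<beta> v)"
  and linear_left: "Vector_Spaces.linear (*s) (*) (\<lambda>v. \<beta> v w)"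
  using form unfolding eps_form_def by auto

lemma form_simps [simp]:
  "\<beta> (u + v) w = \<beta> u w + \<beta> v w" "\<beta> w (u + v) = \<beta> w u + \<beta> w v"
  "\<beta> (x *s v) w = x * \<beta> v w" "\<beta> w (x *s v) = x * \<beta> w v"
  using linear_right linear_left by (auto simp: Vector_Spaces.linear_iff)

lemma form_neg_zero [simp]:
  "\<beta> 0 w = 0" "\<beta> w 0 = 0" "\<beta> (- v) w = - \<beta> v w" "\<beta> w (- v) = - \<beta> w v"
  using form_simps(3)[of 0 v w] form_simps(4)[of w 0 v] form_simps(3)[of "-1" v w]
    form_simps(4)[of w "-1" v] by simp_all

lemma form_diff [simp]:
  "\<beta> (u - v) w = \<beta> u w - \<beta> v w" "\<beta> w (u - v) = \<beta> w u - \<beta> w v"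
  using form_simps(1)[of u "- v" w] form_simps(2)[of w u "- v"] by simp_all

lemma form_sum: "\<beta> (\<Sum>i\<in>I. f i) w = (\<Sum>i\<in>I. \<beta> (f i) w)"
  by (induction I rule: infinite_finite_induct) auto

lemma form_nondeg_eq: "(\<And>v. \<beta> v w = \<beta> v w') \<Longrightarrow> w = w'"
  using form_nondeg[of "w - w'"] form_sym by auto

lemma subspace_form_perp: "vec.subspace (form_perp \<beta> W)"
  by (auto simp: vec.subspace_def form_perp_def)

text \<open>Pairing with a basis of the whole space that extends a basis of \<open>W\<close> is an
  isomorphism \<open>L\<close> onto coordinate space, by non-degeneracy. It carries the orthogonal
  of \<open>W\<close> onto the vectors whose coordinates at the basis of \<open>W\<close>
  vanish.\<close>

lemma dim_form_perp:
  assumes "vec.subspace W"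
  shows "vec.dim (form_perp \<beta> W) + vec.dim W = CARD('n)"
proof -
  obtain C where C: "C \<subseteq> W" "vec.independent C" "W \<subseteq> vec.span C" "card C = vec.dim W"
    using vec.basis_exists by blast
  obtain E where E: "C \<subseteq> E" "vec.independent E" "UNIV \<subseteq> vec.span E"
    using vec.maximal_independent_subset_extend[of C UNIV] C(2) by auto
  have "card E = CARD('n)" "finite E"
    using vec.dim_eq_card[of E UNIV] E vec_dim_card[where 'n='n and 'a=complex] vec.finiteI_independent
    by (auto simp del: vec.dim_UNIV simp: top.extremum_unique)
  then obtain e :: "'n \<Rightarrow> complex^'n" where e: "bij_betw e UNIV E"
    by (metis finite_same_card_bij finite)
  define L where "L v = (\<chi> i. \<beta> v (e i))" for v
  have span0: "\<beta> v w = 0" if "\<And>u. u \<in> T \<Longrightarrow> \<beta> v u = 0" "w \<in> vec.span T" for v w T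
    using that(2) by (induction rule: vec.span_induct) (auto simp: vec.subspace_def that(1))
  have linL: "Vector_Spaces.linear (*s) (*s) L"
    by (simp add: Vector_Spaces.linear_iff L_def vec_eq_iff vec.vector_space_axioms)
  have "v = 0" if "L v = 0" for v
  proof (rule form_nondeg)
    fix w
    have "\<beta> v u = 0" if "u \<in> E" for u
      using that \<open>L v = 0\<close> e by (auto simp: L_def vec_eq_iff bij_betw_def)
    then show "\<beta> v w = 0"
      using span0[of E v w] E(3) by blast
  qed
  then have injL: "inj L"
    using vec.linear_inj_iff_eq_0[OF linL] by blast
  then have surjL: "surj L"
    using vec.linear_inj_imp_surj[OF linL] by blast
  define J where "J = {i. e i \<in> C}"
  have "e ` J = C"
    using e E(1) by (auto simp: J_def bij_betw_def)
  then have cardJ: "card J = vec.dim W"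
    using e C(4) by (metis bij_betw_def card_image inj_on_subset subset_UNIV)
  \<comment> \<open>The double negation \<open>i \<notin> - J\<close> only says
    \<open>i \<in> J\<close>; it gives the set the shape that \<open>dim_substandard_cart\<close>
    measures.\<close>
  have "L v \<in> {x. \<forall>i. i \<notin> - J \<longrightarrow> x $ i = 0} \<longleftrightarrow> v \<in> form_perp \<beta> W" for v
  proof -
    have "L v \<in> {x. \<forall>i. i \<notin> - J \<longrightarrow> x $ i = 0} \<longleftrightarrow> (\<forall>u\<in>C. \<beta> v u = 0)"
      using \<open>e ` J = C\<close> by (auto simp: L_def)
    also have "\<dots> \<longleftrightarrow> v \<in> form_perp \<beta> W"
      using span0[of C v] C(1,3) by (auto simp: form_perp_def)
    finally show ?thesis .
  qed
  then have "L ` form_perp \<beta> W = {x. \<forall>i. i \<notin> - J \<longrightarrow> x $ i = 0}"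
    using surjL by (auto simp: image_iff) (metis surjD)+
  moreover have "vec.dim (L ` form_perp \<beta> W) = vec.dim (form_perp \<beta> W)"
    using vec.dim_image_eq[OF linL] injL inj_on_subset by blast
  ultimately have "vec.dim (form_perp \<beta> W) = card (UNIV - J)"
    by (simp only: dim_substandard_cart Compl_eq_Diff_UNIV)
  moreover have "card (UNIV - J) = CARD('n) - card J" "card J \<le> CARD('n)"
    by (simp_all add: card_Diff_subset card_mono)
  ultimately show ?thesis
    using cardJ by linarith
qed

lemma form_adjoint_eqI:
  assumes "\<And>v w. \<beta> (A *v v) w = \<beta> v (A' *v w)"
  shows "form_adjoint \<beta> A = A'"
  unfolding form_adjoint_def
proof (rule the_equality)
  fix A'' assume "\<forall>v w. \<beta> (A *v v) w = \<beta> v (A'' *v w)"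
  then show "A'' = A'"
    using assms form_nondeg_eq by (metis matrix_eq)
qed (use assms in blast)

text \<open>\<open>form_adjoint\<close> is a definite description, so a witness is needed. If
  \<open>M\<close> is the Gram matrix of the form, invertible by non-degeneracy, the adjoint is the
  inverse of \<open>M\<close> times \<open>transpose A\<close> times \<open>M\<close>; invertibility
  passes from \<open>A\<close> to this product.\<close>

lemma form_adjoint_works:
  shows "\<beta> (A *v v) w = \<beta> v (form_adjoint \<beta> A *v w)"
    and "invertible A \<Longrightarrow> invertible (form_adjoint \<beta> A)"
proof -
  define M where "M = matrix (\<lambda>w. \<chi> i. \<beta> (axis i 1) w)"
  have "Vector_Spaces.linear (*s) (*s) (\<lambda>w. \<chi> i. \<beta> (axis i 1) w)"
    by (simp add: Vector_Spaces.linear_iff vec_eq_iff vec.vector_space_axioms)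
  then have Mw: "M *v w = (\<chi> i. \<beta> (axis i 1) w)" for w
    unfolding M_def by (simp add: matrix_works)
  have \<beta>M: "\<beta> v w = (\<Sum>i\<in>UNIV. v $ i * (M *v w) $ i)" for v w
    using form_sum[of "\<lambda>i. v $ i *s axis i 1" UNIV w] by (simp add: Mw basis_expansion)
  have "w = 0" if "M *v w = 0" for w
    using form_nondeg[of w] \<beta>M[of _ w] form_sym that by simp
  then have "inj ((*v) M)"
    using vec.linear_inj_iff_eq_0[OF matrix_vector_mul_linear_gen] by blast
  then obtain N where N: "N ** M = mat 1"
    using matrix_left_invertible_injective by blast
  then have MN: "M ** N = mat 1"
    by (simp add: matrix_left_right_inverse)
  define A' where "A' = N ** transpose A ** M"
  have adj: "\<beta> (A *v v) w = \<beta> v (A' *v w)" for v w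
  proof -
    have "M ** A' = transpose A ** M"
      by (simp add: A'_def matrix_mul_assoc MN)
    then have m: "M *v (A' *v w) = transpose A *v (M *v w)"
      by (simp only: matrix_vector_mul_assoc)
    have u: "(M *v (A' *v w)) $ i = (\<Sum>j\<in>UNIV. A $ j $ i * (M *v w) $ j)" for i
      unfolding m matrix_vector_mult_def[of "transpose A"] by (simp add: transpose_def)
    have "\<beta> (A *v v) w = (\<Sum>j\<in>UNIV. \<Sum>i\<in>UNIV. v $ i * (A $ j $ i * (M *v w) $ j))"
      unfolding \<beta>M[of "A *v v" w] by (simp add: matrix_vector_mult_def[of A v] sum_distrib_left mult_ac)
    also have "\<dots> = (\<Sum>i\<in>UNIV. \<Sum>j\<in>UNIV. v $ i * (A $ j $ i * (M *v w) $ j))"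
      by (rule sum.swap)
    also have "\<dots> = \<beta> v (A' *v w)"
      unfolding \<beta>M[of v "A' *v w"] u sum_distrib_left ..
    finally show ?thesis .
  qed
  then have A': "form_adjoint \<beta> A = A'"
    by (rule form_adjoint_eqI)
  show "\<beta> (A *v v) w = \<beta> v (form_adjoint \<beta> A *v w)"
    by (simp add: A' adj)
  show "invertible (form_adjoint \<beta> A)" if "invertible A"
  proof -
    have "invertible N" "invertible M"
      using N MN unfolding invertible_def by blast+
    moreover have "invertible (transpose A)"
      using that left_invertible_transpose[of A]
      by (metis invertible_left_inverse invertible_right_inverse)
    ultimately show ?thesis
      unfolding A' A'_def by (intro invertible_mult)
  qed
qed

text \<open>Being fixed by \<open>rho\<close> means that \<open>g\<close> is inverse to its own
  adjoint, so \<open>g\<close> on both sides of the form cancels.\<close>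

lemma rho_fixed_isometry:
  assumes "invertible g" "rho \<beta> g = g"
  shows "\<beta> (g *v v) (g *v w) = \<beta> v w"
proof -
  obtain h where h: "h ** form_adjoint \<beta> g = mat 1"
    using form_adjoint_works(2)[OF assms(1)] by (auto simp: invertible_def)
  then have "h = g"
    using matrix_inv_eqI assms(2) unfolding rho_def by metis
  then have "form_adjoint \<beta> g ** g = mat 1"
    using h by (simp add: matrix_left_right_inverse)
  then show ?thesis
    by (simp add: form_adjoint_works(1) matrix_vector_mul_assoc)
qed

end


section \<open>Maximal isotropic flags in even dimension\<close>

text \<open>For \<open>l = 1\<close> the only skew matrix of square zero is 0, and the closures
  agree. With \<open>l \<ge> 2\<close> the index \<open>l - 1\<close> is at least 1, so
  \<open>F (l - 1)\<close> is a nonzero member of the flag.\<close>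

locale even_maximal_flag = quadratic_space \<beta>
  for \<beta> :: "complex^'n \<Rightarrow> complex^'n \<Rightarrow> complex" +
  fixes l :: nat and F :: "nat \<Rightarrow> (complex^'n) set"
  assumes card_eq: "CARD('n) = 2 * l" and l_ge: "l \<ge> 2" and flag: "max_isotropic_flag \<beta> l F"
begin

lemma flag_member:
  assumes "1 \<le> i" "i \<le> l"
  shows "vec.subspace (F i)" "vec.dim (F i) = i"
    and "v \<in> F i \<Longrightarrow> w \<in> F i \<Longrightarrow> \<beta> v w = 0"
  using flag assms unfolding max_isotropic_flag_def isotropic_subspace_def by auto

lemma flag_mono: "1 \<le> i \<Longrightarrow> i \<le> j \<Longrightarrow> j \<le> l \<Longrightarrow> F i \<subseteq> F j"
proof (induction j rule: nat_induct)
  case (Suc j)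
  show ?case
  proof (cases "i = Suc j")
    case False
    then have "F i \<subseteq> F j" "F j \<subseteq> F (Suc j)"
      using Suc flag unfolding max_isotropic_flag_def by auto
    then show ?thesis by blast
  qed simp
qed simp

text \<open>Isotropy gives one inclusion, and the dimensions agree because the whole space has
  dimension exactly \<open>2 * l\<close>. This is where evenness enters.\<close>

lemma perp_top: "form_perp \<beta> (F l) = F l"
proof (rule sym, rule vec.subspace_dim_equal)
  show "vec.subspace (F l)" "vec.subspace (form_perp \<beta> (F l))"
    using flag_member l_ge subspace_form_perp by auto
  show "F l \<subseteq> form_perp \<beta> (F l)"
    using flag_member(3)[of l] l_ge by (auto simp: form_perp_def)
  show "vec.dim (form_perp \<beta> (F l)) \<le> vec.dim (F l)"
    using dim_form_perp[of "F l"] flag_member(1,2)[of l] l_ge card_eq by simp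
qed

lemma exists_adapted_vectors:
  obtains a b c where "a \<noteq> 0" "a \<in> F (l - 1)" "b \<in> F l" "\<beta> b c = 1" "\<beta> c c = 0"
    "c \<in> form_perp \<beta> (F (l - 1))" "F l = vec.span (insert b (F (l - 1)))"
proof -
  let ?W = "F (l - 1)"
  have W: "vec.subspace ?W" "vec.dim ?W = l - 1" "?W \<subseteq> F l" and Fl: "vec.subspace (F l)" "vec.dim (F l) = l"
    using flag_member[of "l - 1"] flag_member[of l] flag_mono[of "l - 1" l] l_ge by auto
  have "\<not> ?W \<subseteq> {0}"
    using W(2) l_ge vec.dim_eq_0[of ?W] by auto
  then obtain a where a: "a \<noteq> 0" "a \<in> ?W" by blast
  have "?W \<noteq> F l"
    using W(2) Fl(2) l_ge by auto
  then obtain b where b: "b \<in> F l" "b \<notin> ?W"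
    using W(3) by blast
  \<comment> \<open>Since \<open>b\<close> lies outside the double orthogonal of \<open>?W\<close>,
    some vector orthogonal to \<open>?W\<close> pairs nontrivially with \<open>b\<close>.\<close>
  have "?W = form_perp \<beta> (form_perp \<beta> ?W)"
  proof (rule vec.subspace_dim_equal)
    show "?W \<subseteq> form_perp \<beta> (form_perp \<beta> ?W)"
      using form_sym by (auto simp: form_perp_def)
    show "vec.dim (form_perp \<beta> (form_perp \<beta> ?W)) \<le> vec.dim ?W"
      using dim_form_perp[OF W(1)] dim_form_perp[OF subspace_form_perp, of ?W] by simp
  qed (use W subspace_form_perp in auto)
  then obtain c' where c': "c' \<in> form_perp \<beta> ?W" "\<beta> b c' \<noteq> 0"
    using b(2) unfolding form_perp_def by blast
  \<comment> \<open>Rescaling makes the pairing with \<open>b\<close> equal to 1. As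
    \<open>b\<close> is isotropic, subtracting a multiple of \<open>b\<close> keeps that pairing,
    and this multiple cancels the square of \<open>c''\<close>.\<close>
  define c'' where "c'' = (1 / \<beta> b c') *s c'"
  define c where "c = c'' - (\<beta> c'' c'' / 2) *s b"
  have bb: "\<beta> b b = 0" and bW: "b \<in> form_perp \<beta> ?W"
    using flag_member(3)[of l] l_ge b W(3) by (auto simp: form_perp_def)
  have bc'': "\<beta> b c'' = 1" "\<beta> c'' b = 1"
    using c' form_sym[of c'' b] by (auto simp: c''_def)
  have "\<beta> b c = 1" "\<beta> c c = 0"
    by (simp_all add: c_def bb bc'')
  moreover have "c \<in> form_perp \<beta> ?W"
    using c' bW by (auto simp: c_def c''_def form_perp_def)
  moreover have "F l = vec.span (insert b ?W)"
  proof (rule sym, rule vec.subspace_dim_equal)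
    show "vec.span (insert b ?W) \<subseteq> F l"
      using b W(3) Fl(1) by (intro vec.span_minimal) auto
    have "b \<notin> vec.span ?W"
      using b W(1) by (metis vec.span_eq_iff)
    then show "vec.dim (F l) \<le> vec.dim (vec.span (insert b ?W))"
      using W(2) Fl(2) by (simp add: vec.dim_insert)
  qed (use Fl in auto)
  ultimately show ?thesis
    using that a b by blast
qed

section \<open>Degeneration of \<open>A\<close> to \<open>X\<close> under the larger group\<close>

lemma not_induced_by_type_A: "\<not> induced_by_type_A \<beta> l F"
proof
  assume ind: "induced_by_type_A \<beta> l F"
  obtain a b c where a: "a \<noteq> 0" "a \<in> F (l - 1)" and b: "b \<in> F l" and bc: "\<beta> b c = 1"
    and cc: "\<beta> c c = 0" and c: "c \<in> form_perp \<beta> (F (l - 1))"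
    and span: "F l = vec.span (insert b (F (l - 1)))"
    by (rule exists_adapted_vectors)
  have iso: "v \<in> F l \<Longrightarrow> w \<in> F l \<Longrightarrow> \<beta> v w = 0" for v w
    using flag_member(3)[of l] l_ge by auto
  have sub: "F (l - 1) \<subseteq> F l"
    using flag_mono l_ge by auto
  \<comment> \<open>The Gram table: \<open>b\<close> and \<open>c\<close> form a hyperbolic pair
    orthogonal to the isotropic vector \<open>a\<close>.\<close>
  have [simp]: "\<beta> a a = 0" "\<beta> a b = 0" "\<beta> b a = 0" "\<beta> b b = 0" "\<beta> b c = 1" "\<beta> c b = 1"
    "\<beta> c c = 0" "\<beta> c a = 0" "\<beta> a c = 0"
    using iso a b bc cc c sub form_sym[of c b] form_sym[of a c] by (auto simp: form_perp_def)
  have linear_vec: "Vector_Spaces.linear (*s) (*s) f"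
    if "\<And>x y. f (x + y) = f x + f y" "\<And>k x. f (k *s x) = k *s f x" for f :: "complex^'n \<Rightarrow> complex^'n"
    using that by (simp add: Vector_Spaces.linear_iff vec.vector_space_axioms)
  define R where "R u w = matrix (\<lambda>v. \<beta> v w *s u)" for u w :: "complex^'n"
  have R [simp]: "R u w *v v = \<beta> v w *s u" for u w v
    unfolding R_def by (subst matrix_works, rule linear_vec) (simp_all add: vec_eq_iff algebra_simps)
  define A where "A = R a c - R c a"
  define X where "X = R a b - R b a"
  \<comment> \<open>The direction of the curve from \<open>X\<close>. It is self-adjoint and
    nonzero, so the curve leaves the skew matrices as soon as it leaves \<open>X\<close>.\<close>
  define Y where "Y = R a c + R c a"
  have A [simp]: "A *v v = \<beta> v c *s a - \<beta> v a *s c" for v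
    by (simp add: A_def matrix_vector_mult_diff_rdistrib)
  have X [simp]: "X *v v = \<beta> v b *s a - \<beta> v a *s b" for v
    by (simp add: X_def matrix_vector_mult_diff_rdistrib)
  \<comment> \<open>The image lies in the span of \<open>u\<close> and \<open>w\<close>, which the
    matrix kills because that span is totally isotropic. Symmetry of the form makes the two rank-one
    terms adjoint to each other, hence their difference skew.\<close>
  have skew: "R u w - R w u \<in> nilp2_skew \<beta>" if "\<beta> u u = 0" "\<beta> w w = 0" "\<beta> u w = 0" for u w
  proof -
    have wu: "\<beta> w u = 0" using that form_sym by metis
    have "(R u w - R w u) *v ((R u w - R w u) *v v) = 0" for v
      using that wu by (simp add: matrix_vector_mult_diff_rdistrib)
    then have "(R u w - R w u) ** (R u w - R w u) = 0"
      by (simp add: matrix_eq flip: matrix_vector_mul_assoc)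
    moreover have "form_adjoint \<beta> (R u w - R w u) = - (R u w - R w u)"
    proof (rule form_adjoint_eqI)
      fix x y
      show "\<beta> ((R u w - R w u) *v x) y = \<beta> x (- (R u w - R w u) *v y)"
        by (simp add: matrix_vector_mult_diff_rdistrib form_sym[of _ y])
    qed
    ultimately show ?thesis
      by (simp add: nilp2_skew_def nilp2_def)
  qed
  have A_skew: "A \<in> nilp2_skew \<beta>" and X_skew: "X \<in> nilp2_skew \<beta>"
    unfolding A_def X_def by (rule skew; simp)+

  \<comment> \<open>\<open>g t\<close> maps \<open>b\<close> to \<open>b / t\<close> and \<open>c\<close> to \<open>b - t c\<close>; its inverse is \<open>g (1 / t)\<close>.\<close>
  define g where "g t = matrix (\<lambda>v. v + ((1 / t - 1) * \<beta> v c) *s b + \<beta> v b *s (b - (1 + t) *s c))" for t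
  have g: "g t *v v = v + ((1 / t - 1) * \<beta> v c) *s b + \<beta> v b *s (b - (1 + t) *s c)" for t v
    unfolding g_def by (subst matrix_works, rule linear_vec) (simp_all add: vec_eq_iff algebra_simps)
  have g_inv: "g (1 / t) ** g t = mat 1" if "t \<noteq> 0" for t
    using that by (simp add: matrix_eq g vec_eq_iff field_simps flip: matrix_vector_mul_assoc)
  \<comment> \<open>\<open>g t\<close> changes \<open>v\<close> by multiples of \<open>b\<close> and
    \<open>c\<close> with coefficients governed by the pairings with \<open>c\<close> and
    \<open>b\<close>. Both pairings vanish on \<open>F (l - 1)\<close>, only the \<open>b\<close>
    term survives on \<open>F l\<close>, and for \<open>i < l\<close> the orthogonal of
    \<open>F i\<close> contains both \<open>b\<close> and \<open>c\<close>.\<close>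
  have g_into: "g t *v v \<in> W" if W: "W \<in> complete_flag \<beta> l F" and v: "v \<in> W" for t v W
  proof -
    have base: "g t *v v = v + ((1 / t - 1) * \<beta> v c) *s b" if "v \<in> F l" for v
      using iso[OF that b] by (simp add: g)
    have fix_lower: "g t *v v = v" if "v \<in> F (l - 1)" for v
      using base[of v] sub c form_sym[of v c] that by (auto simp: form_perp_def)
    have top: "g t *v v \<in> F l" if "v \<in> F l" for v
      using base[OF that] flag_member(1)[of l] l_ge b that
      by (auto intro: vec.subspace_add vec.subspace_scale)
    have lower: "F i \<subseteq> F (l - 1)" if "i \<in> {1..l}" "i \<noteq> l" for i
      using that by (intro flag_mono) auto
    consider i where "i \<in> {1..l}" "i \<noteq> l" "W = F i" | "W = F l"
      | i where "i \<in> {1..l}" "i \<noteq> l" "W = form_perp \<beta> (F i)"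
    proof -
      obtain i where i: "i \<in> {1..l}" "W = F i \<or> W = form_perp \<beta> (F i)"
        using W unfolding complete_flag_def by blast
      show ?thesis
      proof (cases "i = l")
        case True
        then have "W = F l"
          using i(2) perp_top by auto
        then show ?thesis by (rule that(2))
      next
        case False
        then show ?thesis
          using i that(1,3) by blast
      qed
    qed
    then show ?thesis
    proof cases
      case 1
      then have "g t *v v = v"
        using lower v by (intro fix_lower) blast
      then show ?thesis using v by simp
    next
      case 2
      then show ?thesis using top v by auto
    next
      case 3
      have "\<beta> b w = 0" "\<beta> c w = 0" if "w \<in> F i" for w
        using lower[OF 3(1,2)] that iso b c sub by (auto simp: form_perp_def)
      then show ?thesis
        using v 3(3) by (auto simp: form_perp_def g)
    qed
  qed
  have g_borel: "g t \<in> borel_GL \<beta> l F" if "t \<noteq> 0" for t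
    unfolding borel_GL_def
  proof (intro CollectI conjI ballI)
    show "invertible (g t)"
      using g_inv[OF that] by (auto simp: invertible_left_inverse)
    fix W assume W: "W \<in> complete_flag \<beta> l F"
    \<comment> \<open>The inverse \<open>g (1 / t)\<close> also maps \<open>W\<close> into itself,
      which upgrades inclusion to equality.\<close>
    have "g t *v (g (1 / t) *v v) = v" for v
      using g_inv[of "1 / t"] that by (simp add: matrix_vector_mul_assoc)
    then show "(*v) (g t) ` W = W"
      using g_into[OF W] by (metis (no_types, lifting) image_iff image_subset_iff subsetI subset_antisym)
  qed
  have conj: "g t ** A ** matrix_inv (g t) = X + (R (t *s a) c + R (t *s c) a)" if "t \<noteq> 0" for t
    unfolding matrix_inv_eqI[OF g_inv[OF that]]
    using that by (simp add: matrix_eq g vec_eq_iff field_simps matrix_vector_mult_add_rdistrib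
        flip: matrix_vector_mul_assoc)

  \<comment> \<open>The conjugates computed above are \<open>X + t Y\<close>; scalar multiplication of matrices is only
    available over the reals, so \<open>t\<close> runs through \<open>1 / (k + 1)\<close>.\<close>
  define Z where "Z k = X + inverse (real (Suc k)) *\<^sub>R Y" for k
  have scale: "R (complex_of_real r *s u) w = r *\<^sub>R R u w" for r u w
    by (simp add: R_def matrix_def vec_eq_iff scaleR_conv_of_real[where 'a=complex])
  have "Z k \<in> conj_orbit (borel_GL \<beta> l F) A" for k
  proof -
    let ?t = "complex_of_real (inverse (real (Suc k)))"
    have t: "?t \<noteq> 0"
      using of_real_eq_0_iff by (metis inverse_nonzero_iff_nonzero of_nat_eq_0_iff nat.simps(3))
    have "Z k = g ?t ** A ** matrix_inv (g ?t)"
      unfolding conj[OF t] scale by (simp add: Z_def Y_def scaleR_add_right)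
    then show ?thesis
      using g_borel[OF t] unfolding conj_orbit_def by blast
  qed
  moreover have "Z \<longlonglongrightarrow> X + 0 *\<^sub>R Y"
    unfolding Z_def by (intro tendsto_intros LIMSEQ_inverse_real_of_nat)
  ultimately have "X + 0 *\<^sub>R Y \<in> zariski_closure (conj_orbit (borel_GL \<beta> l F) A)"
    by (rule zariski_closure_limit)
  then have "X \<in> zariski_closure (conj_orbit (borel_GL \<beta> l F) A)"
    by simp
  then have X_in: "X \<in> zariski_closure (conj_orbit (borel_fixed \<beta> l F) A)"
    using ind A_skew X_skew unfolding induced_by_type_A_def by blast

  \<comment> \<open>Obstruction for isometries stabilizing the flag\<close>
  have "M *v c = 0" if M: "M \<in> conj_orbit (borel_fixed \<beta> l F) A" for M
  proof -
    obtain h where hB: "h \<in> borel_fixed \<beta> l F" and Mh: "M = h ** A ** matrix_inv h"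
      using M unfolding conj_orbit_def by (rule imageE)
    have h: "invertible h" "rho \<beta> h = h" and h_flag: "\<And>W. W \<in> complete_flag \<beta> l F \<Longrightarrow> (*v) h ` W = W"
      using hB by (simp_all add: borel_fixed_def borel_GL_def)
    have h_iso: "\<beta> (h *v v) (h *v w) = \<beta> v w" for v w
      using rho_fixed_isometry[OF h] by blast
    obtain k where k: "k ** h = mat 1" "h ** k = mat 1"
      using h(1) unfolding invertible_def by blast
    \<comment> \<open>With \<open>v\<close> the preimage of \<open>c\<close> under \<open>h\<close>,
      the claim becomes \<open>A *v v = 0\<close>, that is, \<open>v\<close> is orthogonal to
      \<open>a\<close> and to \<open>c\<close>.\<close>
    define v where "v = k *v c"
    have hv: "h *v v = c"
      by (simp add: v_def matrix_vector_mul_assoc k)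
    have vv: "\<beta> v v = 0"
      using h_iso[of v v] hv by simp
    have mem: "F (l - 1) \<in> complete_flag \<beta> l F" "F l \<in> complete_flag \<beta> l F"
      using l_ge unfolding complete_flag_def by auto
    have v_perp: "\<beta> v u = 0" if "u \<in> F (l - 1)" for u
    proof -
      have "h *v u \<in> F (l - 1)"
        using h_flag[OF mem(1)] that by blast
      then have "\<beta> c (h *v u) = 0"
        using c by (auto simp: form_perp_def)
      then show ?thesis
        using h_iso[of v u] hv by simp
    qed
    \<comment> \<open>\<open>F l\<close> is its own orthogonal and is spanned by \<open>b\<close>
      and \<open>F (l - 1)\<close>, so pairings with these decide membership.\<close>
    have perp_topI: "w \<in> F l" if "\<beta> w b = 0" "\<And>u. u \<in> F (l - 1) \<Longrightarrow> \<beta> w u = 0" for w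
    proof -
      have "\<beta> w u = 0" if "u \<in> F l" for u
        using that unfolding span
        by (induction rule: vec.span_induct)
          (use \<open>\<beta> w b = 0\<close> \<open>\<And>u. u \<in> F (l - 1) \<Longrightarrow> \<beta> w u = 0\<close> in \<open>auto simp: vec.subspace_def\<close>)
      then show ?thesis
        using perp_top by (auto simp: form_perp_def)
    qed
    \<comment> \<open>Otherwise \<open>v\<close> would lie in \<open>F l\<close>, and so would its
      image \<open>c\<close>, although \<open>c\<close> pairs to 1 with \<open>b\<close>.\<close>
    have vb: "\<beta> v b \<noteq> 0"
    proof
      assume "\<beta> v b = 0"
      then have "v \<in> F l"
        using perp_topI v_perp by blast
      then have "c \<in> F l"
        using h_flag[OF mem(2)] hv by blast
      then show False
        using iso[OF b, of c] by simp
    qed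
    \<comment> \<open>The part of \<open>v\<close> lying in the orthogonal of \<open>F l\<close>, that is, in \<open>F l\<close> itself.\<close>
    define w where "w = v - \<beta> v c *s b - \<beta> v b *s c"
    have "w \<in> F l"
      using v_perp c iso[OF b] sub by (intro perp_topI) (auto simp: w_def form_perp_def)
    then have "\<beta> w w = 0"
      using iso by blast
    \<comment> \<open>As \<open>v\<close> is isotropic, the square of \<open>w\<close> expands to -2
      times this product.\<close>
    then have "\<beta> v c * \<beta> v b = 0"
      by (simp add: w_def vv form_sym[of b v] form_sym[of c v] algebra_simps)
    then have "\<beta> v c = 0"
      using vb by simp
    then have "A *v v = 0"
      using v_perp[OF a(2)] by simp
    then have "h *v (A *v (k *v c)) = 0"
      by (simp add: v_def)
    then show ?thesis
      unfolding Mh matrix_inv_eqI[OF k(1)] by (simp only: matrix_vector_mul_assoc matrix_mul_assoc)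
  qed
  then have "zariski_closure (conj_orbit (borel_fixed \<beta> l F) A) \<subseteq> {M. M *v c = 0}"
    unfolding zariski_closure_def
    by (intro hull_minimal) (auto intro: zariski_closed_annihilator)
  then show False
    using X_in a(1) by auto
qed

end

theorem corollary5p2:
  fixes \<beta> :: "complex^'n \<Rightarrow> complex^'n \<Rightarrow> complex"
    and F :: "nat \<Rightarrow> (complex^'n) set"
    and l :: nat
  assumes "CARD('n) = 2 * l"
    and "l \<ge> 2"
    and "eps_form 1 \<beta>"
    and "max_isotropic_flag \<beta> l F"
  shows "\<not> induced_by_type_A \<beta> l F"
proof -
  interpret even_maximal_flag \<beta> l F
    using assms by unfold_locales
  show ?thesis
    by (rule not_induced_by_type_A)
qed

end
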